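(* Let $n$ be a positive integer, let $\alpha \in (0,1)$, and let $\mathcal{A}$ be a random set in $\mathcal{B}(n,\alpha)$. Define $\beta_0 := 1$, $\beta_1 := 1$, and $\beta_{i+1} := (1-\alpha)\beta_i + \alpha(1-\alpha)\beta_{i-1}$ for all integers $i \geq 1$, and put $\gamma_i := \beta_{i-1}\beta_{i+1}/\beta_i^2$ for all integers $i \geq 1$. Then, for all positive integers $r < s \leq n$ with $\gcd(r,s) = 1$, we have $$\mathbb{P}\big(r/s \in \mathcal{A}/\mathcal{A}\big) = 1 - \exp\big({-}\delta(s)\,n + O_\alpha(1)\big),$$ where $$\delta(s) := \sum_{i=1}^\infty \frac{\log(1/\gamma_i)}{s^i}$$ is an absolutely convergent series.
   Context: For a positive integer $n$ and $\alpha \in (0,1)$, $\mathcal{B}(n,\alpha)$ denotes the probabilistic model in which a random set $\mathcal{A} \subseteq \{1,\dots,n\}$ is constructed by picking independently every element of $\{1,\dots,n\}$ with probability $\alpha$. The ratio set of $\mathcal{A}$ is $\mathcal{A}/\mathcal{A} := \{a/b : a,b \in \mathcal{A}\}$. The notation $O_\alpha(1)$ denotes a real quantity whose absolute value is bounded by a constant depending only on $\alpha$ (in particular, uniformly in $n$, $r$, $s$). The quantities $\beta_i$, $\gamma_i$, $\delta(s)$ depend on $\alpha$. *)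

theory Defs
  imports "HOL-Probability.Probability"
begin

definition random_subset_pmf :: "nat \<Rightarrow> real \<Rightarrow> nat set pmf" where
  "random_subset_pmf n \<alpha> =
     map_pmf (\<lambda>f. {k \<in> {1..n}. f k}) (Pi_pmf {1..n} False (\<lambda>_. bernoulli_pmf \<alpha>))"

definition ratio_set :: "nat set \<Rightarrow> rat set" where
  "ratio_set A = {of_nat a / of_nat b | a b. a \<in> A \<and> b \<in> A}"

fun beta_seq :: "real \<Rightarrow> nat \<Rightarrow> real" where
  "beta_seq \<alpha> 0 = 1"
| "beta_seq \<alpha> (Suc 0) = 1"
| "beta_seq \<alpha> (Suc (Suc i)) = (1 - \<alpha>) * beta_seq \<alpha> (Suc i) + \<alpha> * (1 - \<alpha>) * beta_seq \<alpha> i"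

(* Meaningful for i \<ge> 1 only: for i = 0 the subtraction i - 1 truncates. *)
definition gamma_seq :: "real \<Rightarrow> nat \<Rightarrow> real" where
  "gamma_seq \<alpha> i = beta_seq \<alpha> (i - 1) * beta_seq \<alpha> (i + 1) / (beta_seq \<alpha> i)\<^sup>2"

(* delta_term \<alpha> s i is the summand of index i + 1: the series starts at index 1. *)
definition delta_term :: "real \<Rightarrow> nat \<Rightarrow> nat \<Rightarrow> real" where
  "delta_term \<alpha> s i = ln (1 / gamma_seq \<alpha> (Suc i)) / real s ^ Suc i"

definition delta :: "real \<Rightarrow> nat \<Rightarrow> real" where
  "delta \<alpha> s = (\<Sum>i. delta_term \<alpha> s i)"

end

theory Submission
  imports Defs
begin

text \<open>
  The ratio \<open>r/s\<close> is avoided iff the random set is independent in the graph with edges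
  \<open>{k r, k s}\<close>. Its components are paths, and \<open>v\<close> has exactly \<open>multiplicity s v\<close> predecessors
  \<open>v r/s, v (r/s)\<^sup>2, \<dots>\<close> on its path. A random subset of a path with \<open>m\<close> vertices is independent with
  probability \<open>\<beta>\<^sub>m\<close>, so \<open>v\<close> contributes the factor
  \<open>\<beta>\<^bsub>m+1\<^esub>/\<beta>\<^sub>m = \<gamma>\<^sub>1 \<cdots> \<gamma>\<^sub>m\<close> with \<open>m = multiplicity s v\<close>. Counting multiples of \<open>s\<^sup>i\<close>, the
  logarithm of the avoidance probability is the sum of \<open>\<lfloor>n/s\<^sup>i\<rfloor> log \<gamma>\<^sub>i\<close> over \<open>i \<ge> 1\<close>. Removing the floors costs
  at most the sum of \<open>\<bar>log \<gamma>\<^sub>i\<bar>\<close>, which is finite because a Cassini-type identity makes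
  \<open>\<gamma>\<^sub>i - 1\<close> decay like \<open>\<alpha>\<^sup>i\<close>.
\<close>

section \<open>The sequences \<open>\<beta>\<close> and \<open>\<gamma>\<close>\<close>

lemma beta_seq_pos:
  assumes "0 < \<alpha>" "\<alpha> < 1"
  shows "0 < beta_seq \<alpha> i"
  using assms by (induction \<alpha> i rule: beta_seq.induct) (auto intro!: add_pos_pos)

lemma beta_seq_Suc_ge:
  assumes "0 < \<alpha>" "\<alpha> < 1"
  shows "(1 - \<alpha>) * beta_seq \<alpha> i \<le> beta_seq \<alpha> (Suc i)"
  using assms beta_seq_pos[OF assms, of "i - 1"] by (cases i) auto

text \<open>In the recurrence, \<open>(1 - \<alpha>) * beta_seq \<alpha> j\<close> is at most
  \<open>beta_seq \<alpha> (Suc j)\<close>, so the two coefficients become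
  \<open>1 - \<alpha>\<close> and \<open>\<alpha>\<close>, which add up to 1.\<close>

lemma beta_seq_Suc_le:
  assumes "0 < \<alpha>" "\<alpha> < 1"
  shows "beta_seq \<alpha> (Suc i) \<le> beta_seq \<alpha> i"
proof (cases i)
  case (Suc j)
  have "\<alpha> * ((1 - \<alpha>) * beta_seq \<alpha> j) \<le> \<alpha> * beta_seq \<alpha> (Suc j)"
    using assms beta_seq_Suc_ge[OF assms, of j] by (intro mult_left_mono) auto
  then show ?thesis
    by (simp add: Suc algebra_simps)
qed auto

lemma beta_seq_add2_ge:
  assumes "0 < \<alpha>" "\<alpha> < 1"
  shows "(1 - \<alpha>) * beta_seq \<alpha> i \<le> beta_seq \<alpha> (i + 2)"
proof -
  have "(1 - \<alpha>) * ((1 - \<alpha>) * beta_seq \<alpha> i) \<le> (1 - \<alpha>) * beta_seq \<alpha> (Suc i)"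
    using assms beta_seq_Suc_ge[OF assms, of i] by (intro mult_left_mono) auto
  then show ?thesis
    by (simp add: algebra_simps)
qed

text \<open>Two steps of the recurrence cost a single factor \<open>1 - \<alpha>\<close>. The
  exponent \<open>i\<close> rather than \<open>2 * i\<close> lets this bound cancel the power of
  \<open>1 - \<alpha>\<close> in the Cassini identity.\<close>

lemma beta_seq_square_ge:
  assumes "0 < \<alpha>" "\<alpha> < 1"
  shows "(1 - \<alpha>) ^ i \<le> (beta_seq \<alpha> i)\<^sup>2"
proof (induction i rule: induct_nat_012)
  case (ge2 i)
  have "(1 - \<alpha>) ^ Suc (Suc i) = (1 - \<alpha>)\<^sup>2 * (1 - \<alpha>) ^ i"
    by (simp add: power2_eq_square)
  also have "\<dots> \<le> (1 - \<alpha>)\<^sup>2 * (beta_seq \<alpha> i)\<^sup>2"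
    using ge2 by (intro mult_left_mono) auto
  also have "\<dots> = ((1 - \<alpha>) * beta_seq \<alpha> i)\<^sup>2"
    by (simp add: power_mult_distrib)
  also have "\<dots> \<le> (beta_seq \<alpha> (i + 2))\<^sup>2"
    using assms beta_seq_add2_ge[OF assms, of i] beta_seq_pos[OF assms, of i]
    by (intro power_mono) auto
  finally show ?case by simp
qed (use assms in auto)

text \<open>Each step multiplies the left side by the determinant
  \<open>- (\<alpha> * (1 - \<alpha>))\<close> of the recurrence matrix; the initial value is
  \<open>- \<alpha>\<^sup>2\<close>.\<close>

lemma beta_seq_Cassini:
  "beta_seq \<alpha> i * beta_seq \<alpha> (i + 2) - (beta_seq \<alpha> (i + 1))\<^sup>2
     = - (\<alpha>\<^sup>2 * (- (\<alpha> * (1 - \<alpha>))) ^ i)"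
proof (induction i)
  case (Suc i)
  have "beta_seq \<alpha> (Suc i) * beta_seq \<alpha> (Suc i + 2) - (beta_seq \<alpha> (Suc i + 1))\<^sup>2
      = - (\<alpha> * (1 - \<alpha>)) *
          (beta_seq \<alpha> i * beta_seq \<alpha> (i + 2) - (beta_seq \<alpha> (i + 1))\<^sup>2)"
    by (simp add: power2_eq_square algebra_simps)
  then show ?case
    by (simp only: Suc.IH power_Suc mult_minus_left mult_minus_right mult.left_commute)
qed (simp add: power2_eq_square algebra_simps)

lemma gamma_seq_ge:
  assumes "0 < \<alpha>" "\<alpha> < 1"
  shows "1 - \<alpha> \<le> gamma_seq \<alpha> (Suc i)"
proof -
  have "(1 - \<alpha>) * (beta_seq \<alpha> (Suc i))\<^sup>2
      = beta_seq \<alpha> (Suc i) * ((1 - \<alpha>) * beta_seq \<alpha> (Suc i))"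
    by (simp add: power2_eq_square)
  also have "\<dots> \<le> beta_seq \<alpha> i * beta_seq \<alpha> (Suc (Suc i))"
    using assms beta_seq_Suc_le[OF assms, of i] beta_seq_Suc_ge[OF assms, of "Suc i"]
      beta_seq_pos[OF assms, of "Suc i"] beta_seq_pos[OF assms, of i]
    by (intro mult_mono) auto
  finally show ?thesis
    using beta_seq_pos[OF assms, of "Suc i"]
    by (simp add: gamma_seq_def pos_le_divide_eq del: beta_seq.simps)
qed

lemma gamma_seq_minus_one_le:
  assumes "0 < \<alpha>" "\<alpha> < 1"
  shows "\<bar>gamma_seq \<alpha> (Suc i) - 1\<bar> \<le> \<alpha> ^ (i + 2) / (1 - \<alpha>)"
proof -
  have pos: "0 < beta_seq \<alpha> (Suc i)"
    by (rule beta_seq_pos[OF assms])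
  then have "gamma_seq \<alpha> (Suc i) - 1 =
      (beta_seq \<alpha> i * beta_seq \<alpha> (i + 2) - (beta_seq \<alpha> (i + 1))\<^sup>2) / (beta_seq \<alpha> (Suc i))\<^sup>2"
    by (simp add: gamma_seq_def diff_divide_distrib del: beta_seq.simps)
  also have "\<bar>\<dots>\<bar> = \<alpha>\<^sup>2 * (\<alpha> * (1 - \<alpha>)) ^ i / (beta_seq \<alpha> (Suc i))\<^sup>2"
    using assms unfolding beta_seq_Cassini by (simp add: abs_mult power_abs)
  \<comment> \<open>After cancelling \<open>(1 - \<alpha>) ^ i\<close>, only the geometric factor
    \<open>\<alpha> ^ i\<close> depends on \<open>i\<close>.\<close>
  also have "\<dots> \<le> \<alpha>\<^sup>2 * (\<alpha> * (1 - \<alpha>)) ^ i / (1 - \<alpha>) ^ Suc i"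
    using assms beta_seq_square_ge[OF assms, of "Suc i"] pos
    by (intro divide_left_mono) auto
  also have "\<dots> = \<alpha> ^ (i + 2) / (1 - \<alpha>)"
    using assms by (simp add: power_mult_distrib power_add power2_eq_square)
  finally show ?thesis .
qed

section \<open>Summability of the logarithms of \<gamma>\<close>

lemma abs_ln_le:
  fixes c x :: real
  assumes "0 < c" "c \<le> 1" "c \<le> x"
  shows "\<bar>ln x\<bar> \<le> \<bar>x - 1\<bar> / c"
proof -
  have "ln x \<le> x - 1" "ln (1 / x) \<le> 1 / x - 1"
    using assms by (intro ln_le_minus_one; simp)+
  moreover have "1 / x - 1 = (1 - x) / x"
    using assms by (simp add: field_simps)
  moreover have "(1 - x) / x \<le> \<bar>x - 1\<bar> / c"
    using assms by (intro frac_le) auto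
  moreover have "x - 1 \<le> \<bar>x - 1\<bar> / c"
    using assms frac_le[of "\<bar>x - 1\<bar>" "x - 1" c 1] by auto
  moreover have "ln (1 / x) = - ln x"
    using assms by (simp add: ln_div)
  ultimately show ?thesis by linarith
qed

lemma abs_ln_gamma_seq_le:
  assumes "0 < \<alpha>" "\<alpha> < 1"
  shows "\<bar>ln (gamma_seq \<alpha> (Suc i))\<bar> \<le> \<alpha> ^ (i + 2) / (1 - \<alpha>)\<^sup>2"
proof -
  have "\<bar>ln (gamma_seq \<alpha> (Suc i))\<bar> \<le> \<bar>gamma_seq \<alpha> (Suc i) - 1\<bar> / (1 - \<alpha>)"
    using assms gamma_seq_ge[OF assms, of i] by (intro abs_ln_le) auto
  also have "\<dots> \<le> \<alpha> ^ (i + 2) / (1 - \<alpha>) / (1 - \<alpha>)"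
    using assms gamma_seq_minus_one_le[OF assms, of i] by (intro divide_right_mono) auto
  finally show ?thesis by (simp add: power2_eq_square)
qed

lemma summable_abs_ln_gamma_seq:
  assumes "0 < \<alpha>" "\<alpha> < 1"
  shows "summable (\<lambda>i. \<bar>ln (gamma_seq \<alpha> (Suc i))\<bar>)"
proof (rule summable_comparison_test')
  show "summable (\<lambda>i. \<alpha> ^ i * (\<alpha>\<^sup>2 / (1 - \<alpha>)\<^sup>2))"
    using assms by (intro summable_mult2 summable_geometric) auto
  show "norm \<bar>ln (gamma_seq \<alpha> (Suc i))\<bar> \<le> \<alpha> ^ i * (\<alpha>\<^sup>2 / (1 - \<alpha>)\<^sup>2)" if "0 \<le> i" for i
    using abs_ln_gamma_seq_le[OF assms, of i] by (simp add: power2_eq_square power_add ac_simps)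
qed

text \<open>Each \<gamma> is a quotient of two consecutive ratios of \<beta>, so the product
  telescopes; the first ratio is 1.\<close>

lemma prod_gamma_seq:
  assumes "0 < \<alpha>" "\<alpha> < 1"
  shows "(\<Prod>i<m. gamma_seq \<alpha> (Suc i)) = beta_seq \<alpha> (Suc m) / beta_seq \<alpha> m"
proof (induction m)
  case (Suc m)
  then show ?case
    using beta_seq_pos[OF assms, of m] beta_seq_pos[OF assms, of "Suc m"]
    by (simp add: gamma_seq_def power2_eq_square del: beta_seq.simps)
qed auto

section \<open>Random subsets of a finite set\<close>

text \<open>The given model on an arbitrary ground set, so that an induction can delete vertices one
  at a time.\<close>

definition random_subset_of :: "'a set \<Rightarrow> real \<Rightarrow> 'a set pmf" where
  "random_subset_of V \<alpha> =
     map_pmf (\<lambda>f. {k \<in> V. f k}) (Pi_pmf V False (\<lambda>_. bernoulli_pmf \<alpha>))"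

lemma random_subset_of_empty [simp]: "random_subset_of {} \<alpha> = return_pmf {}"
  by (simp add: random_subset_of_def)

lemma set_random_subset_of: "A \<in> set_pmf (random_subset_of V \<alpha>) \<Longrightarrow> A \<subseteq> V"
  by (auto simp: random_subset_of_def)

lemma random_subset_of_insert:
  assumes "finite V" "v \<notin> V"
  shows "random_subset_of (insert v V) \<alpha> =
    bernoulli_pmf \<alpha> \<bind> (\<lambda>b. map_pmf (\<lambda>A. if b then insert v A else A) (random_subset_of V \<alpha>))"
proof -
  have eq: "{k \<in> insert v V. (f(v := b)) k} =
      (if b then insert v {k \<in> V. f k} else {k \<in> V. f k})" for f b
    using assms by auto
  show ?thesis
    unfolding random_subset_of_def Pi_pmf_insert'[OF assms]
    unfolding map_pmf_def bind_assoc_pmf bind_return_pmf eq ..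
qed

lemma prob_random_subset_of_insert:
  assumes "finite V" "v \<notin> V" "0 \<le> \<alpha>" "\<alpha> \<le> 1"
  shows "measure_pmf.prob (random_subset_of (insert v V) \<alpha>) S =
    \<alpha> * measure_pmf.prob (random_subset_of V \<alpha>) {A. insert v A \<in> S} +
    (1 - \<alpha>) * measure_pmf.prob (random_subset_of V \<alpha>) S"
proof -
  have "measure_pmf.prob (random_subset_of (insert v V) \<alpha>) S =
    (\<integral>b. measure_pmf.prob (map_pmf (\<lambda>A. if b then insert v A else A) (random_subset_of V \<alpha>)) S
       \<partial>bernoulli_pmf \<alpha>)"
    unfolding random_subset_of_insert[OF assms(1,2)] measure_pmf_bind
    by (rule measure_pmf.measure_bind[where N = "count_space UNIV"])
       (auto intro: measure_pmf_in_subprob_algebra)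
  also have "\<dots> = \<alpha> * measure_pmf.prob (random_subset_of V \<alpha>) {A. insert v A \<in> S} +
    (1 - \<alpha>) * measure_pmf.prob (random_subset_of V \<alpha>) S"
    using assms by (simp add: vimage_def mult.commute)
  finally show ?thesis .
qed

lemma prob_random_subset_of_cong:
  assumes "\<And>A. A \<subseteq> V \<Longrightarrow> A \<in> S \<longleftrightarrow> A \<in> T"
  shows "measure_pmf.prob (random_subset_of V \<alpha>) S = measure_pmf.prob (random_subset_of V \<alpha>) T"
  using assms
  by (intro measure_pmf.finite_measure_eq_AE) (auto simp: AE_measure_pmf_iff dest!: set_random_subset_of)

section \<open>The probability of avoiding a ratio\<close>

text \<open>Independence in the graph with edges \<open>{k * r, k * s}\<close>. The case
  \<open>k = 0\<close> merely forces \<open>0 \<notin> A\<close>, which holds for sets of positive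
  integers.\<close>

definition avoids_ratio :: "nat \<Rightarrow> nat \<Rightarrow> nat set \<Rightarrow> bool" where
  "avoids_ratio r s A \<longleftrightarrow> (\<forall>k. \<not> (k * r \<in> A \<and> k * s \<in> A))"

lemma mem_ratio_set_iff:
  assumes "0 < r" "0 < s" "coprime r s" "0 \<notin> A"
  shows "of_nat r / of_nat s \<in> ratio_set A \<longleftrightarrow> \<not> avoids_ratio r s A"
proof
  assume "of_nat r / of_nat s \<in> ratio_set A"
  then obtain a b where ab: "a \<in> A" "b \<in> A" "(of_nat r / of_nat s :: rat) = of_nat a / of_nat b"
    by (auto simp: ratio_set_def)
  with assms have "b > 0" by (cases "b = 0") auto
  with ab(3) assms have "(of_nat (r * b) :: rat) = of_nat (a * s)"
    by (simp add: field_simps)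
  then have eq: "r * b = a * s"
    by (simp only: of_nat_eq_iff)
  then have "s dvd b"
    using assms(3) by (metis coprime_commute coprime_dvd_mult_right_iff dvd_triv_right)
  then obtain k where k: "b = k * s" by (metis dvdE mult.commute)
  with eq assms have "a = k * r" by (simp add: mult.commute)
  with ab k show "\<not> avoids_ratio r s A"
    by (auto simp: avoids_ratio_def)
next
  assume "\<not> avoids_ratio r s A"
  then obtain k where k: "k * r \<in> A" "k * s \<in> A"
    by (auto simp: avoids_ratio_def)
  with assms have "k \<noteq> 0" by (cases "k = 0") auto
  then have "(of_nat r / of_nat s :: rat) = of_nat (k * r) / of_nat (k * s)"
    using assms by simp
  with k show "of_nat r / of_nat s \<in> ratio_set A"
    unfolding ratio_set_def by blast
qed

text \<open>Powers of \<open>s\<close> are coprime to \<open>r\<close>. Hence moving from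
  \<open>k * s\<close> to its predecessor \<open>k * r\<close> lowers the multiplicity by exactly
  one.\<close>

lemma multiplicity_mult_coprime:
  fixes r s k :: nat
  assumes "coprime r s"
  shows "multiplicity s (k * r) = multiplicity s k"
  using assms by (intro multiplicity_cong coprime_dvd_mult_left_iff) (simp add: coprime_commute)

text \<open>Closure of \<open>V\<close> under predecessors guarantees that the multiplicity of
  \<open>s\<close> in a vertex counts its predecessors inside \<open>V\<close>.\<close>

lemma prob_avoids_ratio:
  assumes \<alpha>: "0 < \<alpha>" "\<alpha> < 1"
    and rs: "0 < r" "r < s" "coprime r s"
    and V: "finite V" "0 \<notin> V" "\<And>k. k * s \<in> V \<Longrightarrow> k * r \<in> V"
  shows "measure_pmf.prob (random_subset_of V \<alpha>) {A. avoids_ratio r s A} =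
    (\<Prod>v\<in>V. \<Prod>i<multiplicity s v. gamma_seq \<alpha> (Suc i))"
  using V
proof (induction V rule: finite_psubset_induct)
  case (psubset V)
  \<comment> \<open>The maximum of \<open>V\<close> is an end of its path; deleting it, or it and its only neighbour,
    leaves a closed set.\<close>
  let ?P = "\<lambda>V. measure_pmf.prob (random_subset_of V \<alpha>)"
  let ?S = "{A. avoids_ratio r s A}"
  let ?G = "\<lambda>v. \<Prod>i<multiplicity s v. gamma_seq \<alpha> (Suc i)"
  show ?case
  proof (cases "V = {}")
    case True
    then show ?thesis by (simp add: avoids_ratio_def)
  next
    case False
    define v where "v = Max V"
    define W where "W = V - {v}"
    have v: "v \<in> V" and max: "\<And>w. w \<in> V \<Longrightarrow> w \<le> v"
      using False psubset.hyps by (auto simp: v_def)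
    have V_eq: "V = insert v W" and W: "finite W" "v \<notin> W" "W \<subset> V"
      using v psubset.hyps by (auto simp: W_def)
    have less: "k * r < k * s" if "k * s \<in> V \<or> k * r \<in> V" for k
      using that psubset.prems(1) rs by (cases "k = 0") auto
    have W_closed: "k * r \<in> W" if "k * s \<in> W" for k
      using that psubset.prems(2)[of k] less[of k] max[of "k * s"] by (auto simp: W_def)
    have IH_W: "?P W ?S = (\<Prod>v\<in>W. ?G v)"
      using W W_closed psubset.prems(1) by (intro psubset.IH) (auto simp: W_def)
    have ins: "?P V ?S = \<alpha> * ?P W {A. avoids_ratio r s (insert v A)} + (1 - \<alpha>) * ?P W ?S"
      using prob_random_subset_of_insert[OF W(1,2), of \<alpha> ?S] \<alpha> by (simp add: V_eq)
    \<comment> \<open>The maximal vertex has no successor, since a successor would be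
      larger.\<close>
    have not_r: "k * s \<notin> V" if "k * r = v" for k
      using that less[of k] max[of "k * s"] by auto
    show ?thesis
    proof (cases "s dvd v")
      case False
      \<comment> \<open>Here \<open>v\<close> has neither predecessor nor successor, so choosing it
        does not affect independence.\<close>
      have "?P W {A. avoids_ratio r s (insert v A)} = ?P W ?S"
      proof (rule prob_random_subset_of_cong, simp)
        fix A assume "A \<subseteq> W"
        moreover have "k * s \<noteq> v" for k
          using False by auto
        ultimately show "avoids_ratio r s (insert v A) \<longleftrightarrow> avoids_ratio r s A"
          using not_r W(3) unfolding avoids_ratio_def by blast
      qed
      then have "?P V ?S = ?P W ?S"
        by (simp add: ins algebra_simps)
      moreover have "multiplicity s v = 0"
        using False by (rule not_dvd_imp_multiplicity_0)
      ultimately show ?thesis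
        using W by (simp add: IH_W V_eq)
    next
      case True
      then obtain k where k: "v = k * s" by (metis dvdE mult.commute)
      define u where "u = k * r"
      define U where "U = W - {u}"
      have "k > 0"
        using k v psubset.prems(1) by (cases "k = 0") auto
      have "u \<in> W"
        using psubset.prems(2)[of k] less[of k] v k by (auto simp: u_def W_def)
      then have W_eq: "W = insert u U" and U: "finite U" "u \<notin> U" "U \<subset> V"
        using W by (auto simp: U_def)
      \<comment> \<open>Only \<open>v\<close> has \<open>u\<close> as its predecessor, and
        \<open>v\<close> is already deleted.\<close>
      have U_closed: "j * r \<in> U" if "j * s \<in> U" for j
        using that W_closed[of j] W(2) k rs by (auto simp: U_def u_def)
      have IH_U: "?P U ?S = (\<Prod>v\<in>U. ?G v)"
        using U U_closed psubset.prems(1) by (intro psubset.IH) auto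
      have "?P W {A. avoids_ratio r s (insert v A)} = ?P W {A. u \<notin> A \<and> avoids_ratio r s A}"
      proof (rule prob_random_subset_of_cong, simp)
        fix A assume A: "A \<subseteq> W"
        have s_iff: "j * s = v \<longleftrightarrow> j = k" for j
          using k rs by auto
        have "k * r \<noteq> v"
          using \<open>u \<in> W\<close> W by (auto simp: u_def)
        then have "j * r \<in> insert v A \<and> j * s \<in> insert v A \<longleftrightarrow>
            j * r \<in> A \<and> j * s \<in> A \<or> j = k \<and> k * r \<in> A" for j
          using not_r[of j] s_iff[of j] v A W(3) by (cases "j = k") auto
        then show "avoids_ratio r s (insert v A) \<longleftrightarrow> u \<notin> A \<and> avoids_ratio r s A"
          unfolding avoids_ratio_def u_def by auto
      qed
      also have "\<dots> = (1 - \<alpha>) * ?P U {A. u \<notin> A \<and> avoids_ratio r s A}"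
        using prob_random_subset_of_insert[OF U(1,2), of \<alpha> "{A. u \<notin> A \<and> avoids_ratio r s A}"] \<alpha>
        by (simp add: W_eq)
      also have "?P U {A. u \<notin> A \<and> avoids_ratio r s A} = ?P U ?S"
        using U by (intro prob_random_subset_of_cong) auto
      finally have W_insert: "?P W {A. avoids_ratio r s (insert v A)} = (1 - \<alpha>) * ?P U ?S" .
      have "(\<Prod>v\<in>W. ?G v) = ?G u * (\<Prod>v\<in>U. ?G v)"
        using U by (simp add: W_eq)
      then have *: "?P V ?S = (\<alpha> * (1 - \<alpha>) + (1 - \<alpha>) * ?G u) * (\<Prod>v\<in>U. ?G v)"
        unfolding ins W_insert IH_U IH_W by (simp add: algebra_simps)
      define m where "m = multiplicity s u"
      have mult: "multiplicity s v = Suc m"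
        using multiplicity_times_same[where p = s and x = k] rs \<open>k > 0\<close>
        by (simp add: m_def u_def k multiplicity_mult_coprime mult.commute[of k s])
      have pos: "0 < beta_seq \<alpha> m" "0 < beta_seq \<alpha> (Suc m)"
        using beta_seq_pos[OF \<alpha>] by auto
      \<comment> \<open>With \<open>?G u\<close> a ratio of consecutive \<beta>, this is the
        recurrence for \<beta> divided by \<open>beta_seq \<alpha> m\<close>.\<close>
      have "\<alpha> * (1 - \<alpha>) + (1 - \<alpha>) * ?G u = beta_seq \<alpha> (Suc (Suc m)) / beta_seq \<alpha> m"
        using pos by (simp add: prod_gamma_seq[OF \<alpha>] flip: m_def) (simp add: field_simps)
      also have "\<dots> = ?G v * ?G u"
        using pos by (simp add: prod_gamma_seq[OF \<alpha>] mult del: beta_seq.simps flip: m_def)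
      finally show ?thesis
        using U W \<open>u \<in> W\<close> by (simp only: *) (simp add: V_eq W_eq)
    qed
  qed
qed

section \<open>Counting multiples of powers of \<open>s\<close>\<close>

lemma card_multiples:
  assumes "0 < (d::nat)"
  shows "card {v \<in> {1..n}. d dvd v} = n div d"
proof -
  have "{v \<in> {1..n}. d dvd v} = (\<lambda>k. d * k) ` {1..n div d}"
    using assms by (auto simp: less_eq_div_iff_mult_less_eq mult.commute elim!: dvdE)
  moreover have "inj_on (\<lambda>k. d * k) {1..n div d}"
    using assms by (auto simp: inj_on_def)
  ultimately show ?thesis by (simp add: card_image)
qed

text \<open>Double counting: the factor \<open>g i\<close> occurs for \<open>v\<close> exactly when
  \<open>s ^ Suc i\<close> divides \<open>v\<close>, so exchanging the products leaves a count of
  multiples.\<close>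

lemma prod_multiplicity:
  fixes g :: "nat \<Rightarrow> real"
  assumes "1 < s"
  shows "(\<Prod>v\<in>{1..n}. \<Prod>i<multiplicity s v. g i) = (\<Prod>i<n. g i ^ (n div s ^ Suc i))"
proof -
  have "(\<Prod>i<multiplicity s v. g i) = (\<Prod>i<n. if s ^ Suc i dvd v then g i else 1)"
    if v: "v \<in> {1..n}" for v
  proof -
    have iff: "s ^ Suc i dvd v \<longleftrightarrow> i < multiplicity s v" for i
      using v assms by (subst power_dvd_iff_le_multiplicity) auto
    \<comment> \<open>The uniform range \<open>i < n\<close> suffices because
      \<open>i < s ^ i \<le> v \<le> n\<close>; it makes the products exchangeable.\<close>
    have "i < n" if "i < multiplicity s v" for i
    proof -
      have "i < s ^ i" using assms by (simp add: power_gt_expt)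
      also have "s ^ i \<le> s ^ Suc i" using assms by simp
      also have "\<dots> \<le> v" using that v iff[of i] by (intro dvd_imp_le) auto
      finally show ?thesis using v by simp
    qed
    then have "{i \<in> {..<n}. s ^ Suc i dvd v} = {..<multiplicity s v}"
      by (auto simp: iff simp del: power_Suc)
    then show ?thesis
      by (simp add: prod.inter_filter[symmetric] del: power_Suc)
  qed
  then have "(\<Prod>v\<in>{1..n}. \<Prod>i<multiplicity s v. g i) =
      (\<Prod>v\<in>{1..n}. \<Prod>i<n. if s ^ Suc i dvd v then g i else 1)"
    by (rule prod.cong[OF refl])
  also have "\<dots> = (\<Prod>i<n. \<Prod>v\<in>{1..n}. if s ^ Suc i dvd v then g i else 1)"
    by (rule prod.swap)
  also have "\<dots> = (\<Prod>i<n. g i ^ (n div s ^ Suc i))"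
    using assms card_multiples[of "s ^ Suc _" n]
    by (intro prod.cong) (simp_all add: prod.inter_filter[symmetric] del: power_Suc)
  finally show ?thesis .
qed

section \<open>The exponent and its bounded error\<close>

theorem corollary1p1:
  fixes \<alpha> :: real
  assumes "0 < \<alpha>" and "\<alpha> < 1"
  shows "\<exists>C::real. \<forall>n r s :: nat. 0 < n \<longrightarrow> 0 < r \<longrightarrow> r < s \<longrightarrow> s \<le> n \<longrightarrow> coprime r s \<longrightarrow>
           summable (\<lambda>i. \<bar>delta_term \<alpha> s i\<bar>) \<and>
           (\<exists>E::real. \<bar>E\<bar> \<le> C \<and>
              \<P>(A in measure_pmf (random_subset_pmf n \<alpha>). of_nat r / of_nat s \<in> ratio_set A)
                = 1 - exp (- delta \<alpha> s * real n + E))"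
proof (intro exI allI impI)
  fix n r s :: nat
  assume rs: "0 < n" "0 < r" "r < s" "s \<le> n" "coprime r s"
  define g where "g i = gamma_seq \<alpha> (Suc i)" for i
  define l where "l i = ln (g i)" for i
  \<comment> \<open>The error of removing the floor: minus the fractional part of
    \<open>n / s ^ Suc i\<close>.\<close>
  define e where "e i = real (n div s ^ Suc i) - real n / real s ^ Suc i" for i
  have g_pos: "0 < g i" for i
    using gamma_seq_ge[OF assms, of i] assms by (simp add: g_def)
  have sum_l: "summable (\<lambda>i. \<bar>l i\<bar>)"
    using summable_abs_ln_gamma_seq[OF assms] by (simp add: l_def g_def)
  have dterm: "delta_term \<alpha> s i = - l i / real s ^ Suc i" for i
    using g_pos[of i] by (simp add: delta_term_def l_def g_def ln_div)
  have sum_term: "summable (\<lambda>i. \<bar>delta_term \<alpha> s i\<bar>)"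
  proof (rule summable_comparison_test'[OF sum_l])
    fix i
    have "\<bar>l i\<bar> / real s ^ Suc i \<le> \<bar>l i\<bar> / 1"
      using rs by (intro divide_left_mono one_le_power) auto
    then show "norm \<bar>delta_term \<alpha> s i\<bar> \<le> \<bar>l i\<bar>"
      using rs by (simp add: dterm abs_mult)
  qed
  have e: "\<bar>e i\<bar> \<le> 1" for i
  proof -
    have "real (n div s ^ Suc i) = of_int \<lfloor>real n / real (s ^ Suc i)\<rfloor>"
      by (simp only: floor_divide_of_nat_eq of_int_of_nat_eq)
    then show ?thesis
      unfolding e_def of_nat_power[symmetric] by linarith
  qed
  have le_l: "norm (l i * e i) \<le> \<bar>l i\<bar>" for i
    using mult_left_mono[OF e[of i], of "\<bar>l i\<bar>"] by (simp add: abs_mult)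
  have sum_le: "summable (\<lambda>i. norm (l i * e i))"
    using le_l by (intro summable_comparison_test'[OF sum_l]) auto
  \<comment> \<open>The exact exponent splits termwise into the \<delta> part and the error
    \<open>l i * e i\<close>.\<close>
  have "(\<lambda>i. - delta_term \<alpha> s i * real n + l i * e i) sums
      (- delta \<alpha> s * real n + (\<Sum>i. l i * e i))"
    unfolding delta_def using sum_term sum_le
    by (intro sums_add sums_mult2 sums_minus summable_sums)
       (auto intro: summable_rabs_cancel summable_norm_cancel)
  also have "(\<lambda>i. - delta_term \<alpha> s i * real n + l i * e i) =
      (\<lambda>i. l i * real (n div s ^ Suc i))"
    by (simp add: dterm e_def algebra_simps)
  finally have sums: "(\<lambda>i. l i * real (n div s ^ Suc i)) sums
      (- delta \<alpha> s * real n + (\<Sum>i. l i * e i))" .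
  \<comment> \<open>The floors vanish from index \<open>n\<close> on, so the series equals the
    finite sum from the product formula.\<close>
  have "n div s ^ Suc i = 0" if "i \<notin> {..<n}" for i
  proof -
    have "n < s ^ n" using rs by (intro power_gt_expt) auto
    also have "\<dots> \<le> s ^ Suc i" using that rs by (intro power_increasing) auto
    finally show ?thesis by simp
  qed
  then have "(\<lambda>i. l i * real (n div s ^ Suc i)) sums (\<Sum>i<n. l i * real (n div s ^ Suc i))"
    by (intro sums_finite) auto
  with sums have exponent: "- delta \<alpha> s * real n + (\<Sum>i. l i * e i) =
      (\<Sum>i<n. l i * real (n div s ^ Suc i))"
    by (rule sums_unique2)
  have "measure_pmf.prob (random_subset_of {1..n} \<alpha>) {A. avoids_ratio r s A} =
      (\<Prod>v\<in>{1..n}. \<Prod>i<multiplicity s v. gamma_seq \<alpha> (Suc i))"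
  proof (rule prob_avoids_ratio[OF assms rs(2,3,5)])
    fix k assume k: "k * s \<in> {1..n}"
    then have "0 < k" by (cases k) auto
    have "k * r \<le> k * s" using rs by simp
    also have "\<dots> \<le> n" using k by simp
    finally show "k * r \<in> {1..n}" using rs \<open>0 < k\<close> by simp
  qed auto
  also have "\<dots> = (\<Prod>i<n. g i ^ (n div s ^ Suc i))"
    using rs unfolding g_def by (intro prod_multiplicity) auto
  also have "\<dots> = (\<Prod>i<n. exp (l i * real (n div s ^ Suc i)))"
    using g_pos by (intro prod.cong) (auto simp: l_def exp_of_nat2_mult)
  also have "\<dots> = exp (- delta \<alpha> s * real n + (\<Sum>i. l i * e i))"
    unfolding exponent by (simp add: exp_sum)
  finally have avoid: "measure_pmf.prob (random_subset_of {1..n} \<alpha>) {A. avoids_ratio r s A} =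
      exp (- delta \<alpha> s * real n + (\<Sum>i. l i * e i))" .
  have "\<P>(A in measure_pmf (random_subset_pmf n \<alpha>). of_nat r / of_nat s \<in> ratio_set A) =
      measure_pmf.prob (random_subset_of {1..n} \<alpha>) (- {A. avoids_ratio r s A})"
    unfolding random_subset_pmf_def random_subset_of_def[symmetric]
    using rs by (intro prob_random_subset_of_cong) (subst mem_Collect_eq, subst mem_ratio_set_iff, auto)
  also have "\<dots> = 1 - exp (- delta \<alpha> s * real n + (\<Sum>i. l i * e i))"
    using measure_pmf.prob_compl[of "{A. avoids_ratio r s A}" "random_subset_of {1..n} \<alpha>"]
    unfolding avoid by (simp add: Compl_eq_Diff_UNIV)
  finally have prob: "\<P>(A in measure_pmf (random_subset_pmf n \<alpha>). of_nat r / of_nat s \<in> ratio_set A) =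
      1 - exp (- delta \<alpha> s * real n + (\<Sum>i. l i * e i))" .
  \<comment> \<open>The witness for \<open>E\<close> is the sum of \<open>l i * e i\<close>. Since
    \<open>\<bar>e i\<bar> \<le> 1\<close>, it is bounded by the sum of
    \<open>\<bar>l i\<bar>\<close>, which depends on \<alpha> alone and instantiates
    \<open>C\<close>.\<close>
  have "\<bar>\<Sum>i. l i * e i\<bar> \<le> (\<Sum>i. norm (l i * e i))"
    using summable_norm[OF sum_le] by simp
  also have "\<dots> \<le> (\<Sum>i. \<bar>l i\<bar>)"
    using le_l sum_le sum_l by (rule suminf_le)
  finally show "summable (\<lambda>i. \<bar>delta_term \<alpha> s i\<bar>) \<and> (\<exists>E::real. \<bar>E\<bar> \<le> (\<Sum>i. \<bar>ln (gamma_seq \<alpha> (Suc i))\<bar>) \<and>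
      \<P>(A in measure_pmf (random_subset_pmf n \<alpha>). of_nat r / of_nat s \<in> ratio_set A)
        = 1 - exp (- delta \<alpha> s * real n + E))"
    using sum_term prob unfolding l_def g_def by blast
qed

end
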